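(* Let $H$ be a Hopf $*$-algebra over $\mathbb{C}$ and let $V,W$ be left $H$-modules (not necessarily finite-dimensional). (a) The map $b:\mathrm{Hom}_\ell(V,W)\to\mathrm{Hom}_r(\overline V,\overline W)$ given by $b(T)=\overline T$ is a bijective antimodule map. (b) The map $\beta:\overline{\mathrm{Hom}_\ell(V,W)}\to\mathrm{Hom}_r(\overline V,\overline W)$ given by $\beta=b\circ c_{\mathrm{Hom}_\ell(V,W)}^{-1}$, that is, $\beta\big(c_{\mathrm{Hom}_\ell(V,W)}(T)\big)=\overline T$, is an isomorphism of $H$-modules.
   Context: All vector spaces are over $\mathbb{C}$. A Hopf $*$-algebra is a Hopf algebra $H$ over $\mathbb{C}$ (coproduct $\Delta(a)=a_{(1)}\otimes a_{(2)}$, counit $\varepsilon$, antipode $S$) equipped with an antilinear map $*:H\to H$ such that $(a^* )^*=a$, $(ab)^*=b^*a^*$ and $\Delta(a^* )=a_{(1)}^*\otimes a_{(2)}^*$. Its antipode is automatically invertible, with $S^{-1}(a)=S(a^* )^*$. For a vector space $V$, the complex conjugate vector space $\overline{V}$ consists of formal symbols $c_V(v)=\bar v$ ($v\in V$) with $\bar v+\bar w=\overline{v+w}$ and $\lambda\cdot\bar v=\overline{\bar\lambda v}$. For a linear map $T:V\to W$, $\overline T:\overline V\to\overline W$ is the linear map $\overline T(\bar v)=\overline{T(v)}$. If $V$ is a left $H$-module, $\overline V$ is a left $H$-module via $a\rhd\bar v=\overline{S(a)^*\rhd v}$. For left $H$-modules $V,W$, let $\mathrm{Hom}(V,W)$ be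 the space of all linear maps. $\mathrm{Hom}_\ell(V,W)$ denotes this space with the $H$-action $(a\rhd T)(v)=a_{(1)}\rhd T(S(a_{(2)})\rhd v)$, and $\mathrm{Hom}_r(V,W)$ denotes this space with the $H$-action $(a\blacktriangleright T)(v)=a_{(2)}\rhd T(S^{-1}(a_{(1)})\rhd v)$. An antimodule map $F:X\to Y$ between left $H$-modules is an antilinear map with $F(a\rhd x)=S(a)^*\rhd F(x)$ for all $a\in H$, $x\in X$ (where the action on the target is that of the target module). *)

theory Defs
  imports Complex_Main "HOL-Library.Poly_Mapping"
begin

section \<open>Complex vector spaces\<close>

class complex_vector = ab_group_add +
  fixes scaleC :: "complex \<Rightarrow> 'a \<Rightarrow> 'a" (infixr "*\<^sub>C" 75)
  assumes scaleC_add_right: "c *\<^sub>C (x + y) = c *\<^sub>C x + c *\<^sub>C y"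
    and scaleC_add_left: "(c + d) *\<^sub>C x = c *\<^sub>C x + d *\<^sub>C x"
    and scaleC_scaleC: "c *\<^sub>C d *\<^sub>C x = (c * d) *\<^sub>C x"
    and scaleC_one: "1 *\<^sub>C x = x"

global_interpretation complex_vector:
  vector_space "scaleC :: complex \<Rightarrow> 'a \<Rightarrow> 'a::complex_vector"
  by unfold_locales (rule scaleC_add_right scaleC_add_left scaleC_scaleC scaleC_one)+

abbreviation clinear :: "('a::complex_vector \<Rightarrow> 'b::complex_vector) \<Rightarrow> bool" where
  "clinear \<equiv> Vector_Spaces.linear scaleC scaleC"

definition cbilinear :: "('a::complex_vector \<Rightarrow> 'b::complex_vector \<Rightarrow> 'c::complex_vector) \<Rightarrow> bool" where
  "cbilinear f \<longleftrightarrow> (\<forall>a. clinear (\<lambda>b. f a b)) \<and> (\<forall>b. clinear (\<lambda>a. f a b))"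

definition antilinear :: "('a::complex_vector \<Rightarrow> 'b::complex_vector) \<Rightarrow> bool" where
  "antilinear f \<longleftrightarrow> (\<forall>x y. f (x + y) = f x + f y) \<and> (\<forall>c x. f (c *\<^sub>C x) = cnj c *\<^sub>C f x)"

definition antibilinear :: "('a::complex_vector \<Rightarrow> 'b::complex_vector \<Rightarrow> 'c::complex_vector) \<Rightarrow> bool" where
  "antibilinear f \<longleftrightarrow> (\<forall>a. antilinear (\<lambda>b. f a b)) \<and> (\<forall>b. antilinear (\<lambda>a. f a b))"

lemma clinearI:
  fixes f :: "'a::complex_vector \<Rightarrow> 'b::complex_vector"
  assumes "\<And>x y. f (x + y) = f x + f y" "\<And>c x. f (c *\<^sub>C x) = c *\<^sub>C f x"
  shows "clinear f"
  using assms by unfold_locales auto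

lemma clinear_add: "clinear f \<Longrightarrow> f (x + y) = f x + f y"
  by (auto simp: Vector_Spaces.linear_def module_hom.add)

lemma clinear_scale: "clinear f \<Longrightarrow> f (c *\<^sub>C x) = c *\<^sub>C f x"
  by (auto simp: Vector_Spaces.linear_def module_hom.scale)

lemma clinear_diff: "clinear f \<Longrightarrow> f (x - y) = f x - f y"
  by (auto simp: Vector_Spaces.linear_def module_hom.diff)

instantiation complex :: complex_vector
begin
definition scaleC_complex :: "complex \<Rightarrow> complex \<Rightarrow> complex" where
  "scaleC_complex c x = c * x"
instance
  by standard (simp_all add: scaleC_complex_def algebra_simps)
end

instantiation poly_mapping :: (type, complex_vector) complex_vector
begin
definition scaleC_poly_mapping :: "complex \<Rightarrow> ('a \<Rightarrow>\<^sub>0 'b) \<Rightarrow> ('a \<Rightarrow>\<^sub>0 'b)" where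
  "scaleC_poly_mapping c p = Poly_Mapping.map (scaleC c) p"

lemma lookup_scaleC: "Poly_Mapping.lookup (c *\<^sub>C p) k = c *\<^sub>C Poly_Mapping.lookup p k"
  for p :: "'a \<Rightarrow>\<^sub>0 'b"
  by (simp add: scaleC_poly_mapping_def Poly_Mapping.map.rep_eq when_def)

instance
  by standard (rule poly_mapping_eqI; simp add: lookup_scaleC lookup_add
    complex_vector.scale_right_distrib complex_vector.scale_left_distrib)+
end


section \<open>The complex conjugate vector space\<close>

text \<open>
  \<open>to_cconj\<close> is the antilinear bijection \<open>c\<^sub>V\<close> sending \<open>v\<close> to the formal symbol \<open>v\<close>-bar.
\<close>

datatype 'v cconj = to_cconj (of_cconj: 'v)

instantiation cconj :: (complex_vector) complex_vector
begin
definition zero_cconj :: "'a cconj" where "0 = to_cconj 0"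
definition plus_cconj :: "'a cconj \<Rightarrow> 'a cconj \<Rightarrow> 'a cconj" where
  "x + y = to_cconj (of_cconj x + of_cconj y)"
definition uminus_cconj :: "'a cconj \<Rightarrow> 'a cconj" where
  "- x = to_cconj (- of_cconj x)"
definition minus_cconj :: "'a cconj \<Rightarrow> 'a cconj \<Rightarrow> 'a cconj" where
  "x - y = to_cconj (of_cconj x - of_cconj y)"
definition scaleC_cconj :: "complex \<Rightarrow> 'a cconj \<Rightarrow> 'a cconj" where
  "c *\<^sub>C x = to_cconj (cnj c *\<^sub>C of_cconj x)"
instance
  by standard (simp_all add: zero_cconj_def plus_cconj_def uminus_cconj_def minus_cconj_def
    scaleC_cconj_def add_ac complex_vector.scale_right_distrib complex_vector.scale_left_distrib)
end


section \<open>The space of linear maps\<close>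

typedef (overloaded) ('v::complex_vector, 'w::complex_vector) linmap =
  "{T :: 'v \<Rightarrow> 'w. clinear T}"
  morphisms apply_linmap Linmap
  by (rule exI[of _ "\<lambda>_. 0"]) (simp add: clinearI)

setup_lifting type_definition_linmap

instantiation linmap :: (complex_vector, complex_vector) complex_vector
begin
lift_definition zero_linmap :: "('a, 'b) linmap" is "\<lambda>_. 0"
  by (simp add: clinearI)
lift_definition plus_linmap :: "('a, 'b) linmap \<Rightarrow> ('a, 'b) linmap \<Rightarrow> ('a, 'b) linmap"
  is "\<lambda>S T v. S v + T v"
  by (rule clinearI)
    (simp_all add: clinear_add clinear_scale complex_vector.scale_right_distrib)
lift_definition uminus_linmap :: "('a, 'b) linmap \<Rightarrow> ('a, 'b) linmap" is "\<lambda>T v. - T v"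
  by (rule clinearI) (simp_all add: clinear_add clinear_scale)
lift_definition minus_linmap :: "('a, 'b) linmap \<Rightarrow> ('a, 'b) linmap \<Rightarrow> ('a, 'b) linmap"
  is "\<lambda>S T v. S v - T v"
  by (rule clinearI)
    (simp_all add: clinear_add clinear_scale complex_vector.scale_right_diff_distrib)
lift_definition scaleC_linmap :: "complex \<Rightarrow> ('a, 'b) linmap \<Rightarrow> ('a, 'b) linmap"
  is "\<lambda>c T v. c *\<^sub>C T v"
  by (rule clinearI)
    (simp_all add: clinear_add clinear_scale complex_vector.scale_right_distrib mult.commute)
instance
  by standard (transfer; simp add: add_ac
    complex_vector.scale_right_distrib complex_vector.scale_left_distrib)+
end

lift_definition conj_map ::
  "('v::complex_vector, 'w::complex_vector) linmap \<Rightarrow> ('v cconj, 'w cconj) linmap"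
  is "\<lambda>T x. to_cconj (T (of_cconj x))"
  by (rule clinearI) (simp_all add: plus_cconj_def scaleC_cconj_def clinear_add clinear_scale)


section \<open>Tensor products\<close>

text \<open>
  The tensor product is the free complex vector space on the set of pairs, modulo the
  subspace spanned by the bilinearity relations.
\<close>

abbreviation free_pair :: "'a \<Rightarrow> 'b \<Rightarrow> ('a \<times> 'b) \<Rightarrow>\<^sub>0 complex" where
  "free_pair a b \<equiv> Poly_Mapping.single (a, b) 1"

definition tensor_relations ::
  "(('a::complex_vector \<times> 'b::complex_vector) \<Rightarrow>\<^sub>0 complex) set" where
  "tensor_relations = complex_vector.span
     ({free_pair (a + a') b - free_pair a b - free_pair a' b | a a' b. True} \<union>
      {free_pair a (b + b') - free_pair a b - free_pair a b' | a b b'. True} \<union>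
      {free_pair (c *\<^sub>C a) b - c *\<^sub>C free_pair a b | c a b. True} \<union>
      {free_pair a (c *\<^sub>C b) - c *\<^sub>C free_pair a b | c a b. True})"

definition tensor_rel ::
  "(('a::complex_vector \<times> 'b::complex_vector) \<Rightarrow>\<^sub>0 complex) \<Rightarrow> (('a \<times> 'b) \<Rightarrow>\<^sub>0 complex) \<Rightarrow> bool" where
  "tensor_rel p q \<longleftrightarrow> p - q \<in> tensor_relations"

lemma subspace_tensor_relations: "complex_vector.subspace tensor_relations"
  by (simp add: tensor_relations_def)

lemma tensor_relations_closed:
  "0 \<in> tensor_relations"
  "p \<in> tensor_relations \<Longrightarrow> q \<in> tensor_relations \<Longrightarrow> p + q \<in> tensor_relations"
  "p \<in> tensor_relations \<Longrightarrow> c *\<^sub>C p \<in> tensor_relations"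
  "p \<in> tensor_relations \<Longrightarrow> - p \<in> tensor_relations"
  "p \<in> tensor_relations \<Longrightarrow> q \<in> tensor_relations \<Longrightarrow> p - q \<in> tensor_relations"
  using complex_vector.subspace_0[OF subspace_tensor_relations]
    complex_vector.subspace_add[OF subspace_tensor_relations]
    complex_vector.subspace_scale[OF subspace_tensor_relations]
    complex_vector.subspace_neg[OF subspace_tensor_relations]
    complex_vector.subspace_diff[OF subspace_tensor_relations] by blast+

lemma equivp_tensor_rel: "equivp tensor_rel"
proof (rule equivpI)
  show "reflp tensor_rel"
    by (simp add: reflp_def tensor_rel_def tensor_relations_closed)
  show "symp tensor_rel"
    unfolding symp_def tensor_rel_def using tensor_relations_closed(4) by fastforce
  show "transp tensor_rel"
    unfolding transp_def tensor_rel_def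
    by (intro allI impI, drule (1) tensor_relations_closed(2)) simp
qed

quotient_type (overloaded) ('a, 'b) tensor (infixr "\<otimes>" 60) =
    "('a::complex_vector \<times> 'b::complex_vector) \<Rightarrow>\<^sub>0 complex" / tensor_rel
  by (rule equivp_tensor_rel)

instantiation tensor :: (complex_vector, complex_vector) complex_vector
begin
lift_definition zero_tensor :: "'a \<otimes> 'b" is 0 .
lift_definition plus_tensor :: "'a \<otimes> 'b \<Rightarrow> 'a \<otimes> 'b \<Rightarrow> 'a \<otimes> 'b" is "(+)"
  unfolding tensor_rel_def by (drule (1) tensor_relations_closed(2)) (simp add: add_diff_add)
lift_definition uminus_tensor :: "'a \<otimes> 'b \<Rightarrow> 'a \<otimes> 'b" is uminus
  unfolding tensor_rel_def by (drule tensor_relations_closed(4)) simp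
lift_definition minus_tensor :: "'a \<otimes> 'b \<Rightarrow> 'a \<otimes> 'b \<Rightarrow> 'a \<otimes> 'b" is "(-)"
  unfolding tensor_rel_def by (drule (1) tensor_relations_closed(5)) (simp add: algebra_simps)
lift_definition scaleC_tensor :: "complex \<Rightarrow> 'a \<otimes> 'b \<Rightarrow> 'a \<otimes> 'b" is "(*\<^sub>C)"
  unfolding tensor_rel_def
  by (metis tensor_relations_closed(3) complex_vector.scale_right_diff_distrib)
instance
  by standard
    (transfer; simp add: tensor_rel_def tensor_relations_closed add_ac
    complex_vector.scale_right_distrib complex_vector.scale_left_distrib)+
end

lift_definition pure_tensor :: "'a::complex_vector \<Rightarrow> 'b::complex_vector \<Rightarrow> 'a \<otimes> 'b" (infixr "\<otimes>\<^sub>t" 76)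
  is free_pair .

text \<open>
  \<open>tensor_lift f\<close> applies a bilinear expression \<open>f\<close> to a tensor, so that
  \<open>tensor_lift f (\<Delta>(a))\<close> is what Sweedler notation writes as \<open>f a\<^sub>(\<^sub>1\<^sub>) a\<^sub>(\<^sub>2\<^sub>)\<close>;
  \<open>tensor_antilift\<close> does the same for expressions antilinear in both arguments.
\<close>

definition tensor_lift ::
  "('a::complex_vector \<Rightarrow> 'b::complex_vector \<Rightarrow> 'c::complex_vector) \<Rightarrow> 'a \<otimes> 'b \<Rightarrow> 'c" where
  "tensor_lift f = (THE g. clinear g \<and> (\<forall>a b. g (a \<otimes>\<^sub>t b) = f a b))"

definition tensor_antilift ::
  "('a::complex_vector \<Rightarrow> 'b::complex_vector \<Rightarrow> 'c::complex_vector) \<Rightarrow> 'a \<otimes> 'b \<Rightarrow> 'c" where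
  "tensor_antilift f = (THE g. antilinear g \<and> (\<forall>a b. g (a \<otimes>\<^sub>t b) = f a b))"

lemma free_span: "p \<in> complex_vector.span (range (\<lambda>(a, b). free_pair a b))"
  for p :: "('a \<times> 'b) \<Rightarrow>\<^sub>0 complex"
proof (induction p rule: Poly_Mapping.update_induct)
  case const
  show ?case by (rule complex_vector.span_zero)
next
  case (update p k c)
  have "Poly_Mapping.update k c p = p + c *\<^sub>C free_pair (fst k) (snd k)"
    using update.hyps
    by (intro poly_mapping_eqI) (auto simp: lookup_update lookup_add lookup_scaleC lookup_single
        when_def scaleC_complex_def in_keys_iff)
  moreover have "free_pair (fst k) (snd k) \<in> complex_vector.span (range (\<lambda>(a, b). free_pair a b))"
    by (rule complex_vector.span_base) (auto intro: image_eqI[of _ _ k] simp: case_prod_beta)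
  ultimately show ?case
    using update by (simp add: complex_vector.span_add complex_vector.span_scale)
qed

lemma free_lift_exists:
  fixes f :: "'a \<Rightarrow> 'b \<Rightarrow> 'c::complex_vector"
  obtains g where "clinear g" "\<And>a b. g (free_pair a b) = f a b"
proof -
  define g where "g p = (\<Sum>k\<in>Poly_Mapping.keys p. Poly_Mapping.lookup p k *\<^sub>C f (fst k) (snd k))"
    for p :: "('a \<times> 'b) \<Rightarrow>\<^sub>0 complex"
  have g: "g p = (\<Sum>k\<in>A. Poly_Mapping.lookup p k *\<^sub>C f (fst k) (snd k))"
    if "finite A" "Poly_Mapping.keys p \<subseteq> A" for A p
    unfolding g_def using that
    by (intro sum.mono_neutral_left) (auto simp: in_keys_iff)
  have "g (p + q) = g p + g q" for p q
    using g[of "Poly_Mapping.keys p \<union> Poly_Mapping.keys q"] keys_add[of p q]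
    by (simp add: lookup_add complex_vector.scale_left_distrib sum.distrib)
  moreover have "g (c *\<^sub>C p) = c *\<^sub>C g p" for c p
  proof -
    have "Poly_Mapping.keys (c *\<^sub>C p) \<subseteq> Poly_Mapping.keys p"
      by (auto simp: in_keys_iff lookup_scaleC scaleC_complex_def)
    then show ?thesis
      using g[of "Poly_Mapping.keys p" "c *\<^sub>C p"] g[of "Poly_Mapping.keys p" p]
      by (simp add: lookup_scaleC scaleC_complex_def complex_vector.scale_sum_right)
  qed
  ultimately have "clinear g" by (rule clinearI)
  moreover have "g (free_pair a b) = f a b" for a b
    by (simp add: g_def)
  ultimately show thesis by (rule that)
qed

lemma tensor_ext:
  fixes g h :: "'a::complex_vector \<otimes> 'b::complex_vector \<Rightarrow> 'c::ab_group_add"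
  assumes add: "\<And>x y. g (x + y) = g x + g y" "\<And>x y. h (x + y) = h x + h y"
    and scale: "\<And>c x. g x = h x \<Longrightarrow> g (c *\<^sub>C x) = h (c *\<^sub>C x)"
    and pure: "\<And>a b. g (a \<otimes>\<^sub>t b) = h (a \<otimes>\<^sub>t b)"
  shows "g = h"
proof
  fix t :: "'a \<otimes> 'b"
  obtain p where t: "t = abs_tensor p"
    by (metis Quotient_tensor Quotient_abs_rep)
  have "g (abs_tensor p) = h (abs_tensor p)"
    using free_span[of p]
  proof (induction rule: complex_vector.span_induct_alt)
    case base
    have "g 0 = 0" "h 0 = 0" using add(1)[of 0 0] add(2)[of 0 0] by simp_all
    then show ?case by (simp add: zero_tensor.abs_eq[symmetric])
  next
    case (step c x y)
    then obtain a b where "x = free_pair a b" by auto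
    then have "abs_tensor (c *\<^sub>C x + y) = c *\<^sub>C (a \<otimes>\<^sub>t b) + abs_tensor y"
      by (simp add: plus_tensor.abs_eq scaleC_tensor.abs_eq pure_tensor.abs_eq)
    then show ?case using step.IH scale[OF pure] by (simp add: add)
  qed
  then show "g t = h t" by (simp add: t)
qed

lemma tensor_universal:
  assumes "cbilinear f"
  shows "\<exists>!g. clinear g \<and> (\<forall>a b. g (a \<otimes>\<^sub>t b) = f a b)"
proof -
  obtain g where g: "clinear g" "\<And>a b. g (free_pair a b) = f a b"
    using free_lift_exists[of f] by auto
  have f: "f a (b + b') = f a b + f a b'" "f (a + a') b = f a b + f a' b"
    "f (c *\<^sub>C a) b = c *\<^sub>C f a b" "f a (c *\<^sub>C b) = c *\<^sub>C f a b" for a a' b b' c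
    using assms unfolding cbilinear_def
    by (auto dest: clinear_add clinear_scale
        simp: clinear_add[of "\<lambda>a. f a b"] clinear_scale[of "\<lambda>a. f a b"])
  have zero: "g r = 0" if "r \<in> tensor_relations" for r
    using that unfolding tensor_relations_def
  proof (induction rule: complex_vector.span_induct_alt)
    case base
    show ?case using clinear_add[OF g(1), of 0 0] by simp
  next
    case (step c x y)
    then have "g x = 0"
      by (auto simp: clinear_diff[OF g(1)] clinear_scale[OF g(1)] g(2) f)
    with step show ?case by (simp add: clinear_add[OF g(1)] clinear_scale[OF g(1)])
  qed
  have rel: "g p = g q" if "tensor_rel p q" for p q
    using zero[of "p - q"] that by (simp add: tensor_rel_def clinear_diff[OF g(1)])
  define h where "h t = g (rep_tensor t)" for t
  have h: "h (abs_tensor p) = g p" for p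
    unfolding h_def by (rule rel) (metis Quotient3_tensor Quotient3_rep_abs equivp_reflp equivp_tensor_rel)
  have ex: "\<exists>p. t = abs_tensor p" for t :: "'a \<otimes> 'b"
    by (metis Quotient_tensor Quotient_abs_rep)
  have "clinear h"
  proof (rule clinearI)
    show "h (x + y) = h x + h y" for x y
      using ex[of x] ex[of y] by (auto simp: plus_tensor.abs_eq h clinear_add[OF g(1)])
    show "h (c *\<^sub>C x) = c *\<^sub>C h x" for c x
      using ex[of x] by (auto simp: scaleC_tensor.abs_eq h clinear_scale[OF g(1)])
  qed
  moreover have "h (a \<otimes>\<^sub>t b) = f a b" for a b
    by (simp add: pure_tensor.abs_eq h g(2))
  ultimately show ?thesis
    by (intro ex1I[of _ h]) (auto intro!: tensor_ext simp: clinear_add clinear_scale)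
qed

lemma tensor_lift:
  assumes "cbilinear f"
  shows "clinear (tensor_lift f)" "tensor_lift f (a \<otimes>\<^sub>t b) = f a b"
  using theI'[OF tensor_universal[OF assms]] by (auto simp: tensor_lift_def)

lemma antitensor_universal:
  assumes "antibilinear f"
  shows "\<exists>!g. antilinear g \<and> (\<forall>a b. g (a \<otimes>\<^sub>t b) = f a b)"
proof -
  have "cbilinear (\<lambda>a b. to_cconj (f a b))"
    using assms unfolding cbilinear_def antibilinear_def antilinear_def
    by (auto intro!: clinearI simp: plus_cconj_def scaleC_cconj_def)
  then obtain g where g: "clinear g" "\<And>a b. g (a \<otimes>\<^sub>t b) = to_cconj (f a b)"
    using tensor_universal by metis
  have "antilinear (\<lambda>t. of_cconj (g t))"
    by (simp add: antilinear_def clinear_add[OF g(1)] clinear_scale[OF g(1)]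
        plus_cconj_def scaleC_cconj_def)
  with g(2) show ?thesis
    by (intro ex1I[of _ "\<lambda>t. of_cconj (g t)"]) (auto intro!: tensor_ext simp: antilinear_def)
qed

lemma tensor_antilift:
  assumes "antibilinear f"
  shows "antilinear (tensor_antilift f)" "tensor_antilift f (a \<otimes>\<^sub>t b) = f a b"
  using theI'[OF antitensor_universal[OF assms]] by (auto simp: tensor_antilift_def)

definition tensor_map ::
  "('a::complex_vector \<Rightarrow> 'c::complex_vector) \<Rightarrow> ('b::complex_vector \<Rightarrow> 'd::complex_vector) \<Rightarrow>
   'a \<otimes> 'b \<Rightarrow> 'c \<otimes> 'd" where
  "tensor_map f g = tensor_lift (\<lambda>a b. f a \<otimes>\<^sub>t g b)"

definition tensor_assoc ::
  "('a::complex_vector \<otimes> 'b::complex_vector) \<otimes> 'c::complex_vector \<Rightarrow> 'a \<otimes> 'b \<otimes> 'c" where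
  "tensor_assoc = tensor_lift (\<lambda>x c. tensor_lift (\<lambda>a b. a \<otimes>\<^sub>t b \<otimes>\<^sub>t c) x)"


section \<open>Hopf $*$-algebras\<close>

text \<open>
  Class \<open>ring_1\<close> requires \<open>0 \<noteq> 1\<close>; this costs no generality for Hopf algebras, where \<open>\<epsilon>(1) = 1\<close>.
\<close>

class complex_algebra_1 = ring_1 + complex_vector +
  assumes scaleC_mult_left: "(c *\<^sub>C x) * y = c *\<^sub>C (x * y)"
    and scaleC_mult_right: "x * (c *\<^sub>C y) = c *\<^sub>C (x * y)"

definition tensor_mult ::
  "'a::complex_algebra_1 \<otimes> 'b::complex_algebra_1 \<Rightarrow> 'a \<otimes> 'b \<Rightarrow> 'a \<otimes> 'b" where
  "tensor_mult s t =
     tensor_lift (\<lambda>a b. tensor_lift (\<lambda>c d. (a * c) \<otimes>\<^sub>t (b * d)) t) s"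

locale hopf_algebra =
  fixes \<Delta> :: "'h::complex_algebra_1 \<Rightarrow> 'h \<otimes> 'h"
    and \<epsilon> :: "'h \<Rightarrow> complex"
    and S :: "'h \<Rightarrow> 'h"
  assumes clinear_coproduct: "clinear \<Delta>"
    and coproduct_one: "\<Delta> 1 = 1 \<otimes>\<^sub>t 1"
    and coproduct_mult: "\<Delta> (a * b) = tensor_mult (\<Delta> a) (\<Delta> b)"
    and clinear_counit: "clinear \<epsilon>"
    and counit_one: "\<epsilon> 1 = 1"
    and counit_mult: "\<epsilon> (a * b) = \<epsilon> a * \<epsilon> b"
    and clinear_antipode: "clinear S"
    and coassoc: "tensor_assoc (tensor_map \<Delta> id (\<Delta> a)) = tensor_map id \<Delta> (\<Delta> a)"
    and counit_left: "tensor_lift (\<lambda>b c. \<epsilon> b *\<^sub>C c) (\<Delta> a) = a"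
    and counit_right: "tensor_lift (\<lambda>b c. \<epsilon> c *\<^sub>C b) (\<Delta> a) = a"
    and antipode_left: "tensor_lift (\<lambda>b c. S b * c) (\<Delta> a) = \<epsilon> a *\<^sub>C 1"
    and antipode_right: "tensor_lift (\<lambda>b c. b * S c) (\<Delta> a) = \<epsilon> a *\<^sub>C 1"

locale hopf_star_algebra = hopf_algebra \<Delta> \<epsilon> S
  for \<Delta> :: "'h::complex_algebra_1 \<Rightarrow> 'h \<otimes> 'h" and \<epsilon> :: "'h \<Rightarrow> complex" and S :: "'h \<Rightarrow> 'h" +
  fixes star :: "'h \<Rightarrow> 'h"
  assumes antilinear_star: "antilinear star"
    and star_star: "star (star a) = a"
    and star_mult: "star (a * b) = star b * star a"
    and coproduct_star: "\<Delta> (star a) = tensor_antilift (\<lambda>b c. star b \<otimes>\<^sub>t star c) (\<Delta> a)"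


section \<open>Modules\<close>

locale left_module =
  fixes act :: "'h::complex_algebra_1 \<Rightarrow> 'v::complex_vector \<Rightarrow> 'v"
  assumes cbilinear_act: "cbilinear act"
    and act_one: "act 1 v = v"
    and act_mult: "act (a * b) v = act a (act b v)"

definition conj_act ::
  "('h \<Rightarrow> 'h) \<Rightarrow> ('h \<Rightarrow> 'h) \<Rightarrow> ('h \<Rightarrow> 'v \<Rightarrow> 'v) \<Rightarrow> 'h \<Rightarrow> 'v cconj \<Rightarrow> 'v cconj" where
  "conj_act S star act a x = to_cconj (act (star (S a)) (of_cconj x))"

text \<open>
  For modules \<open>actV\<close>, \<open>actW\<close> the function under \<open>Linmap\<close> in the next two definitions is linear,
  and the expression under \<open>tensor_lift\<close> is bilinear.  The antipode of a Hopf $*$-algebra is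
  bijective, with inverse \<open>\<lambda>a. star (S (star a))\<close>, so that \<open>inv S\<close> is a genuine inverse.
\<close>

definition hom_l_act ::
  "('h::complex_algebra_1 \<Rightarrow> 'h \<otimes> 'h) \<Rightarrow> ('h \<Rightarrow> 'h) \<Rightarrow>
   ('h \<Rightarrow> 'v::complex_vector \<Rightarrow> 'v) \<Rightarrow> ('h \<Rightarrow> 'w::complex_vector \<Rightarrow> 'w) \<Rightarrow>
   'h \<Rightarrow> ('v, 'w) linmap \<Rightarrow> ('v, 'w) linmap" where
  "hom_l_act \<Delta> S actV actW a T =
     Linmap (\<lambda>v. tensor_lift (\<lambda>b c. actW b (apply_linmap T (actV (S c) v))) (\<Delta> a))"

definition hom_r_act ::
  "('h::complex_algebra_1 \<Rightarrow> 'h \<otimes> 'h) \<Rightarrow> ('h \<Rightarrow> 'h) \<Rightarrow>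
   ('h \<Rightarrow> 'v::complex_vector \<Rightarrow> 'v) \<Rightarrow> ('h \<Rightarrow> 'w::complex_vector \<Rightarrow> 'w) \<Rightarrow>
   'h \<Rightarrow> ('v, 'w) linmap \<Rightarrow> ('v, 'w) linmap" where
  "hom_r_act \<Delta> S actV actW a T =
     Linmap (\<lambda>v. tensor_lift (\<lambda>b c. actW c (apply_linmap T (actV (inv S b) v))) (\<Delta> a))"

definition antimodule_map ::
  "('h::complex_algebra_1 \<Rightarrow> 'h) \<Rightarrow> ('h \<Rightarrow> 'h) \<Rightarrow>
   ('h \<Rightarrow> 'x::complex_vector \<Rightarrow> 'x) \<Rightarrow> ('h \<Rightarrow> 'y::complex_vector \<Rightarrow> 'y) \<Rightarrow> ('x \<Rightarrow> 'y) \<Rightarrow> bool" where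
  "antimodule_map S star actX actY F \<longleftrightarrow>
     left_module actX \<and> left_module actY \<and> antilinear F \<and>
     (\<forall>a x. F (actX a x) = actY (star (S a)) (F x))"

definition module_isomorphism ::
  "('h::complex_algebra_1 \<Rightarrow> 'x::complex_vector \<Rightarrow> 'x) \<Rightarrow>
   ('h \<Rightarrow> 'y::complex_vector \<Rightarrow> 'y) \<Rightarrow> ('x \<Rightarrow> 'y) \<Rightarrow> bool" where
  "module_isomorphism actX actY F \<longleftrightarrow>
     left_module actX \<and> left_module actY \<and> clinear F \<and> bij F \<and>
     (\<forall>a x. F (actX a x) = actY a (F x))"

end

theory Submission
  imports Defs
begin

text \<open>
  Write \<open>\<sigma>(a) = S(a)\<^sup>*\<close>. The map \<open>\<sigma>\<close> is antilinear and multiplicative, it reverses the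
  coproduct, \<open>\<Delta>(\<sigma>(a)) = \<sigma>(a\<^sub>(\<^sub>2\<^sub>)) \<otimes> \<sigma>(a\<^sub>(\<^sub>1\<^sub>))\<close>, and it is an involution, which amounts to
  \<open>S\<^sup>-\<^sup>1(a) = S(a\<^sup>*)\<^sup>*\<close>. Everything follows from one identity: for linear \<open>T\<close>, the conjugate of
  \<open>\<sigma>(a) \<rhd> T\<close> is the right Hom action of \<open>a\<close> on the conjugate of \<open>T\<close>
  (\<open>conj_map_hom_l_act\<close>). On a vector \<open>v\<close> both sides are the conjugate of
  \<open>\<sigma>(a\<^sub>(\<^sub>2\<^sub>)) \<rhd> T(a\<^sub>(\<^sub>1\<^sub>)\<^sup>* \<rhd> v)\<close>, because \<open>S(\<sigma>(b)) = b\<^sup>*\<close> and \<open>\<sigma>(S\<^sup>-\<^sup>1(b)) = b\<^sup>*\<close>. Read as it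
  stands, the identity says that \<open>\<beta>\<close> is \<open>H\<close>-equivariant; with \<open>\<sigma>(a)\<close> in place of \<open>a\<close> it says
  that \<open>b\<close> is an antimodule map. Bijectivity is elementary, the inverse being conjugation again.

  The substance therefore lies in the classical properties of the antipode: it reverses products
  (\<open>antipode_mult\<close>), it reverses coproducts (\<open>coproduct_antipode\<close>), and
  \<open>* \<circ> S \<circ> *\<close> is its inverse (\<open>antipode_star_antipode\<close>). All three are instances of the
  uniqueness of convolution inverses (\<open>convolution_inverse_unique\<close>), with target algebra the
  convolution algebra of \<open>H\<close>, the algebra \<open>H \<otimes> H\<close>, and \<open>H\<close> itself.

  The left Hom action satisfies the module axioms because \<open>S\<close> is unital and antimultiplicative.
  Those of the right Hom action are then transported along the bijection \<open>\<beta>\<close>.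
\<close>

section \<open>Tensors as finite sums, and spaces of linear maps\<close>

lemma cbilinear_iff:
  "cbilinear f \<longleftrightarrow>
     (\<forall>a b b'. f a (b + b') = f a b + f a b') \<and> (\<forall>k a b. f a (k *\<^sub>C b) = k *\<^sub>C f a b) \<and>
     (\<forall>a a' b. f (a + a') b = f a b + f a' b) \<and> (\<forall>k a b. f (k *\<^sub>C a) b = k *\<^sub>C f a b)"
proof
  assume f: "cbilinear f"
  have "clinear (f a)" "clinear (\<lambda>a. f a b)" for a b
    using f by (auto simp: cbilinear_def)
  from clinear_add[OF this(1)] clinear_scale[OF this(1)]
    clinear_add[OF this(2)] clinear_scale[OF this(2)]
  show "(\<forall>a b b'. f a (b + b') = f a b + f a b') \<and> (\<forall>k a b. f a (k *\<^sub>C b) = k *\<^sub>C f a b) \<and>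
     (\<forall>a a' b. f (a + a') b = f a b + f a' b) \<and> (\<forall>k a b. f (k *\<^sub>C a) b = k *\<^sub>C f a b)"
    by blast
qed (auto simp: cbilinear_def intro!: clinearI)

lemma cbilinearD:
  assumes "cbilinear f"
  shows "f a (b + b') = f a b + f a b'" "f a (k *\<^sub>C b) = k *\<^sub>C f a b"
    "f (a + a') b = f a b + f a' b" "f (k *\<^sub>C a) b = k *\<^sub>C f a b"
  using assms by (simp_all add: cbilinear_iff)

lemma cbilinear_pure_tensor: "cbilinear (\<otimes>\<^sub>t)"
proof -
  have rel: "p - q \<in> tensor_relations \<Longrightarrow> abs_tensor p = abs_tensor q"
    for p q :: "('a \<times> 'b) \<Rightarrow>\<^sub>0 complex"
    by (simp add: tensor.abs_eq_iff tensor_rel_def)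
  show ?thesis
    unfolding cbilinear_iff pure_tensor.abs_eq plus_tensor.abs_eq scaleC_tensor.abs_eq
    by (intro conjI allI; rule rel; unfold tensor_relations_def diff_diff_eq[symmetric];
        rule complex_vector.span_base; blast)
qed

lemmas pure_tensor_simps = cbilinearD[OF cbilinear_pure_tensor]

lemma tensor_finite_sum: "\<exists>xs. t = (\<Sum>(a, b)\<leftarrow>xs. a \<otimes>\<^sub>t b)"
proof -
  obtain p where t: "t = abs_tensor p"
    by (metis Quotient_tensor Quotient_abs_rep)
  have "\<exists>xs. abs_tensor p = (\<Sum>(a, b)\<leftarrow>xs. a \<otimes>\<^sub>t b)"
    using free_span[of p]
  proof (induction rule: complex_vector.span_induct_alt)
    case base
    show ?case by (rule exI[of _ "[]"]) (simp add: zero_tensor.abs_eq)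
  next
    case (step c x y)
    then obtain a b xs where "x = free_pair a b" "abs_tensor y = (\<Sum>(a, b)\<leftarrow>xs. a \<otimes>\<^sub>t b)"
      by auto
    then have "abs_tensor (c *\<^sub>C x + y) = (\<Sum>(a, b)\<leftarrow>(c *\<^sub>C a, b) # xs. a \<otimes>\<^sub>t b)"
      by (simp add: plus_tensor.abs_eq[symmetric] scaleC_tensor.abs_eq[symmetric]
          pure_tensor.abs_eq[symmetric] pure_tensor_simps)
    then show ?case by blast
  qed
  then show ?thesis by (simp add: t)
qed

text \<open>
  This is Sweedler's summation read literally, over one chosen decomposition into pure tensors.
  For bilinear \<open>f\<close> the choice is immaterial and the value is that of \<open>tensor_lift\<close>; the point is
  that additivity in \<open>f\<close> and the exchange with additive maps hold for every \<open>f\<close>, so that nested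
  sums can be manipulated with hardly any side conditions.
\<close>

definition tensor_sum ::
  "('a::complex_vector \<Rightarrow> 'b::complex_vector \<Rightarrow> 'c::complex_vector) \<Rightarrow> 'a \<otimes> 'b \<Rightarrow> 'c" where
  "tensor_sum f t = (\<Sum>(a, b)\<leftarrow>(SOME xs. t = (\<Sum>(a, b)\<leftarrow>xs. a \<otimes>\<^sub>t b)). f a b)"

lemma tensor_sum_pure: "tensor_sum (\<otimes>\<^sub>t) t = t"
  unfolding tensor_sum_def using someI_ex[OF tensor_finite_sum[of t]] by (rule sym)

lemma additive_tensor_sum:
  assumes "\<And>x y. L (x + y) = L x + L y"
  shows "L (tensor_sum f t) = tensor_sum (\<lambda>a b. L (f a b)) t"
proof -
  have "L 0 = 0" using assms[of 0 0] by simp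
  then have "L (\<Sum>(a, b)\<leftarrow>xs. f a b) = (\<Sum>(a, b)\<leftarrow>xs. L (f a b))" for xs
    by (induction xs) (auto simp: assms)
  then show ?thesis by (simp add: tensor_sum_def)
qed

lemma tensor_sum_plus: "tensor_sum (\<lambda>a b. f a b + g a b) t = tensor_sum f t + tensor_sum g t"
proof -
  have "(\<Sum>(a, b)\<leftarrow>xs. f a b + g a b) = (\<Sum>(a, b)\<leftarrow>xs. f a b) + (\<Sum>(a, b)\<leftarrow>xs. g a b)" for xs
    by (induction xs) (auto simp: add_ac)
  then show ?thesis by (simp add: tensor_sum_def)
qed

lemma tensor_sum_scale: "tensor_sum (\<lambda>a b. k *\<^sub>C f a b) t = k *\<^sub>C tensor_sum f t"
  by (rule additive_tensor_sum[symmetric]) (rule scaleC_add_right)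

lemmas tensor_sum_simps = tensor_sum_plus tensor_sum_scale

lemma tensor_lift_eq_sum: "cbilinear f \<Longrightarrow> tensor_lift f t = tensor_sum f t"
  using additive_tensor_sum[of "tensor_lift f" "(\<otimes>\<^sub>t)" t]
  by (simp add: tensor_sum_pure tensor_lift clinear_add)

lemma tensor_antilift_eq_sum: "antibilinear f \<Longrightarrow> tensor_antilift f t = tensor_sum f t"
  using additive_tensor_sum[of "tensor_antilift f" "(\<otimes>\<^sub>t)" t] tensor_antilift[of f]
  by (simp add: tensor_sum_pure antilinear_def)

lemma tensor_sum_of_pure: "cbilinear f \<Longrightarrow> tensor_sum f (a \<otimes>\<^sub>t b) = f a b"
  by (simp add: tensor_lift_eq_sum[symmetric] tensor_lift)

lemma tensor_sum_linear:
  assumes "cbilinear f"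
  shows "tensor_sum f (s + t) = tensor_sum f s + tensor_sum f t"
    "tensor_sum f (k *\<^sub>C t) = k *\<^sub>C tensor_sum f t"
  using tensor_lift(1)[OF assms]
  by (simp_all add: tensor_lift_eq_sum[OF assms, symmetric] clinear_add clinear_scale)

lemma tensor_sum_tensor_sum:
  assumes "cbilinear f"
  shows "tensor_sum f (tensor_sum g t) = tensor_sum (\<lambda>a b. tensor_sum f (g a b)) t"
  by (rule additive_tensor_sum) (rule tensor_sum_linear(1)[OF assms])

lemmas mult_simps = distrib_left distrib_right scaleC_mult_left scaleC_mult_right

lemma tensor_mult_eq_sum:
  "tensor_mult s t = tensor_sum (\<lambda>a b. tensor_sum (\<lambda>c d. (a * c) \<otimes>\<^sub>t (b * d)) t) s"
proof -
  have b: "cbilinear (\<lambda>c d. (a * c) \<otimes>\<^sub>t (b * d))" for a :: 'a and b :: 'b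
    by (simp add: cbilinear_iff mult_simps pure_tensor_simps)
  show ?thesis
    unfolding tensor_mult_def tensor_lift_eq_sum[OF b]
    by (rule tensor_lift_eq_sum)
      (simp add: cbilinear_iff mult_simps pure_tensor_simps tensor_sum_simps)
qed

lemma cbilinear_tensor_mult: "cbilinear tensor_mult"
  unfolding cbilinear_iff tensor_mult_eq_sum
  by (simp add: cbilinear_iff mult_simps pure_tensor_simps tensor_sum_simps tensor_sum_linear)

lemma tensor_mult_pure: "tensor_mult (a \<otimes>\<^sub>t b) (c \<otimes>\<^sub>t d) = (a * c) \<otimes>\<^sub>t (b * d)"
  unfolding tensor_mult_eq_sum
  by (simp add: cbilinear_iff mult_simps pure_tensor_simps tensor_sum_simps tensor_sum_linear
      tensor_sum_of_pure)

lemma tensor_mult_tensor_sum: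
  "tensor_mult (tensor_sum f t) y = tensor_sum (\<lambda>a b. tensor_mult (f a b) y) t"
  "tensor_mult x (tensor_sum f t) = tensor_sum (\<lambda>a b. tensor_mult x (f a b)) t"
  by (rule additive_tensor_sum, rule cbilinearD[OF cbilinear_tensor_mult])+

lemma tensor_mult_assoc: "tensor_mult (tensor_mult x y) z = tensor_mult x (tensor_mult y z)"
  by (subst (1 2) tensor_sum_pure[of x, symmetric], subst (1 2) tensor_sum_pure[of y, symmetric],
      subst (1 2) tensor_sum_pure[of z, symmetric])
    (simp add: tensor_mult_tensor_sum tensor_mult_pure mult.assoc)

lemma tensor_mult_one: "tensor_mult (1 \<otimes>\<^sub>t 1) x = x" "tensor_mult x (1 \<otimes>\<^sub>t 1) = x"
  by (subst (1 2) tensor_sum_pure[of x, symmetric],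
      simp add: tensor_mult_tensor_sum tensor_mult_pure)+

lemma linmap_eqI: "(\<And>v. apply_linmap f v = apply_linmap g v) \<Longrightarrow> f = g"
  by (simp add: apply_linmap_inject[symmetric] fun_eq_iff)

lemma apply_linmap_linear:
  "apply_linmap f (x + y) = apply_linmap f x + apply_linmap f y"
  "apply_linmap f (k *\<^sub>C x) = k *\<^sub>C apply_linmap f x"
  using apply_linmap[of f] by (simp_all add: clinear_add clinear_scale)

lemma apply_tensor_sum:
  "apply_linmap (tensor_sum F t) v = tensor_sum (\<lambda>a b. apply_linmap (F a b) v) t"
  by (rule additive_tensor_sum[of "\<lambda>T. apply_linmap T v"]) (simp add: plus_linmap.rep_eq)

section \<open>Sweedler sums and convolution\<close>

context hopf_algebra
begin

abbreviation sweedler :: "('h \<Rightarrow> 'h \<Rightarrow> 'c::complex_vector) \<Rightarrow> 'h \<Rightarrow> 'c" where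
  "sweedler f a \<equiv> tensor_sum f (\<Delta> a)"

lemmas coproduct_linear = clinear_add[OF clinear_coproduct] clinear_scale[OF clinear_coproduct]
lemmas counit_linear = clinear_add[OF clinear_counit] clinear_scale[OF clinear_counit]
lemmas antipode_linear = clinear_add[OF clinear_antipode] clinear_scale[OF clinear_antipode]

lemmas hopf_linear_simps = cbilinear_iff mult_simps pure_tensor_simps tensor_sum_simps
  tensor_sum_linear coproduct_linear counit_linear antipode_linear scaleC_complex_def
  complex_vector.scale_right_distrib complex_vector.scale_left_distrib mult.left_commute

lemma sweedler_counit_left:
  assumes "clinear f"
  shows "sweedler (\<lambda>b c. \<epsilon> b *\<^sub>C f c) a = f a"
proof -
  have "f (tensor_lift (\<lambda>b c. \<epsilon> b *\<^sub>C c) (\<Delta> a)) = sweedler (\<lambda>b c. \<epsilon> b *\<^sub>C f c) a"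
    by (simp add: tensor_lift_eq_sum hopf_linear_simps additive_tensor_sum[of f]
        clinear_add[OF assms] clinear_scale[OF assms])
  then show ?thesis by (simp add: counit_left)
qed

lemma sweedler_counit_right:
  assumes "clinear f"
  shows "sweedler (\<lambda>b c. \<epsilon> c *\<^sub>C f b) a = f a"
proof -
  have "f (tensor_lift (\<lambda>b c. \<epsilon> c *\<^sub>C b) (\<Delta> a)) = sweedler (\<lambda>b c. \<epsilon> c *\<^sub>C f b) a"
    by (simp add: tensor_lift_eq_sum hopf_linear_simps additive_tensor_sum[of f]
        clinear_add[OF assms] clinear_scale[OF assms])
  then show ?thesis by (simp add: counit_right)
qed

lemma sweedler_antipode_left: "sweedler (\<lambda>b c. S b * c) a = \<epsilon> a *\<^sub>C 1"
  using antipode_left[of a] by (simp add: tensor_lift_eq_sum hopf_linear_simps)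

lemma sweedler_antipode_right: "sweedler (\<lambda>b c. b * S c) a = \<epsilon> a *\<^sub>C 1"
  using antipode_right[of a] by (simp add: tensor_lift_eq_sum hopf_linear_simps)

text \<open>
  Both sides are the values of the linear map on \<open>H \<otimes> H \<otimes> H\<close> induced by \<open>F\<close> at the two iterated
  coproducts of \<open>a\<close>.
\<close>

lemma sweedler_assoc:
  assumes "\<And>c. cbilinear (\<lambda>p q. F p q c)" "\<And>p. cbilinear (F p)"
  shows "sweedler (\<lambda>b c. sweedler (\<lambda>p q. F p q c) b) a = sweedler (\<lambda>p d. sweedler (F p) d) a"
proof -
  note F = cbilinearD[OF assms(1)] cbilinearD[OF assms(2)]
  have F_left: "F (p + p') = (\<lambda>q c. F p q c + F p' q c)"
    "F (k *\<^sub>C p) = (\<lambda>q c. k *\<^sub>C F p q c)" for p p' k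
    by (simp_all add: F fun_eq_iff)
  define G where "G = tensor_sum (\<lambda>p. tensor_sum (F p))"
  have G: "cbilinear (\<lambda>p. tensor_sum (F p))"
    by (simp add: hopf_linear_simps F F_left)
  have bil1: "cbilinear (\<lambda>a b. a \<otimes>\<^sub>t b \<otimes>\<^sub>t c)" for c :: 'h
    by (simp add: hopf_linear_simps)
  have assoc: "tensor_assoc x = tensor_sum (\<lambda>x c. tensor_sum (\<lambda>a b. a \<otimes>\<^sub>t b \<otimes>\<^sub>t c) x) x"
    for x :: "('h \<otimes> 'h) \<otimes> 'h"
    unfolding tensor_assoc_def tensor_lift_eq_sum[OF bil1]
    by (rule tensor_lift_eq_sum) (simp add: hopf_linear_simps)
  have bil2: "cbilinear (\<lambda>x c. tensor_sum (\<lambda>a b. a \<otimes>\<^sub>t b \<otimes>\<^sub>t c) (x :: 'h \<otimes> 'h))"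
    by (simp add: hopf_linear_simps)
  have "tensor_assoc (tensor_map \<Delta> id (\<Delta> a)) =
      sweedler (\<lambda>b c. sweedler (\<lambda>p q. p \<otimes>\<^sub>t q \<otimes>\<^sub>t c) b) a"
    unfolding assoc tensor_map_def
    by (simp add: tensor_lift_eq_sum hopf_linear_simps
        tensor_sum_tensor_sum[OF bil2] tensor_sum_of_pure[OF bil2])
  then have "G (tensor_assoc (tensor_map \<Delta> id (\<Delta> a))) =
      sweedler (\<lambda>b c. sweedler (\<lambda>p q. F p q c) b) a"
    by (simp add: G_def tensor_sum_tensor_sum[OF G] tensor_sum_of_pure[OF G]
        tensor_sum_of_pure[OF assms(2)])
  moreover have "tensor_map id \<Delta> (\<Delta> a) = sweedler (\<lambda>p d. p \<otimes>\<^sub>t \<Delta> d) a"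
    unfolding tensor_map_def by (simp add: tensor_lift_eq_sum hopf_linear_simps)
  then have "G (tensor_map id \<Delta> (\<Delta> a)) = sweedler (\<lambda>p d. sweedler (F p) d) a"
    by (simp add: G_def tensor_sum_tensor_sum[OF G] tensor_sum_of_pure[OF G])
  ultimately show ?thesis by (simp add: coassoc)
qed

lemma sweedler_one: "cbilinear f \<Longrightarrow> sweedler f 1 = f 1 1"
  by (simp add: coproduct_one tensor_sum_of_pure)

lemma sweedler_mult:
  assumes "cbilinear f"
  shows "sweedler f (a * b) = sweedler (\<lambda>p q. sweedler (\<lambda>r s. f (p * r) (q * s)) b) a"
  by (simp add: coproduct_mult tensor_mult_eq_sum tensor_sum_tensor_sum[OF assms]
      tensor_sum_of_pure[OF assms])

text \<open>
  This is the monoid argument \<open>f = f (g h) = (f g) h = h\<close>, carried out for the convolution product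
  of linear maps from \<open>H\<close> to an algebra; associativity comes from coassociativity.
  The target algebra is an explicit operation \<open>m\<close> with unit \<open>u\<close> because it will be
  \<open>H\<close>, \<open>H \<otimes> H\<close> and a convolution algebra in turn.
\<close>

lemma convolution_inverse_unique:
  fixes m :: "'a::complex_vector \<Rightarrow> 'a \<Rightarrow> 'a"
  assumes m: "cbilinear m" and assoc: "\<And>x y z. m (m x y) z = m x (m y z)"
    and unit: "\<And>x. m u x = x" "\<And>x. m x u = x"
    and lin: "clinear f" "clinear g" "clinear h"
    and fg: "\<And>a. sweedler (\<lambda>b c. m (f b) (g c)) a = \<epsilon> a *\<^sub>C u"
    and gh: "\<And>a. sweedler (\<lambda>b c. m (g b) (h c)) a = \<epsilon> a *\<^sub>C u"
  shows "f a = h a"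
proof -
  note m_simps = cbilinearD[OF m] lin[THEN clinear_add] lin[THEN clinear_scale]
  have "f a = sweedler (\<lambda>b c. m (f b) (\<epsilon> c *\<^sub>C u)) a"
    by (simp add: m_simps unit sweedler_counit_right[OF lin(1)])
  also have "\<dots> = sweedler (\<lambda>b d. sweedler (\<lambda>p c. m (f b) (m (g p) (h c))) d) a"
    by (simp add: gh[symmetric] additive_tensor_sum[of "m (f b)" for b] m_simps)
  also have "\<dots> = sweedler (\<lambda>d c. sweedler (\<lambda>b p. m (m (f b) (g p)) (h c)) d) a"
    by (subst sweedler_assoc[symmetric]) (simp_all add: cbilinear_iff m_simps assoc)
  also have "\<dots> = sweedler (\<lambda>d c. m (\<epsilon> d *\<^sub>C u) (h c)) a"
    by (simp add: fg[symmetric] additive_tensor_sum[of "\<lambda>x. m x (h c)" for c] m_simps)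
  also have "\<dots> = h a"
    by (simp add: m_simps unit sweedler_counit_left[OF lin(3)])
  finally show ?thesis .
qed


section \<open>The antipode reverses products and coproducts\<close>

lemma antipode_one: "S 1 = 1"
  using sweedler_antipode_left[of 1]
  by (simp add: sweedler_one hopf_linear_simps counit_one complex_vector.scale_one)

lift_definition convolve :: "('h, 'h) linmap \<Rightarrow> ('h, 'h) linmap \<Rightarrow> ('h, 'h) linmap"
  is "\<lambda>f g. sweedler (\<lambda>b c. f b * g c)"
  by (rule clinearI) (simp_all add: hopf_linear_simps clinear_add clinear_scale)

lemma cbilinear_convolve: "cbilinear convolve"
  unfolding cbilinear_iff by (transfer; simp add: hopf_linear_simps fun_eq_iff)+

lemma apply_convolve:
  "apply_linmap (convolve f g) a = sweedler (\<lambda>b c. apply_linmap f b * apply_linmap g c) a"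
  by (simp add: convolve.rep_eq)

lemma convolve_assoc: "convolve (convolve f g) h = convolve f (convolve g h)"
proof (rule linmap_eqI)
  fix a
  let ?f = "apply_linmap f" and ?g = "apply_linmap g" and ?h = "apply_linmap h"
  have "apply_linmap (convolve (convolve f g) h) a =
      sweedler (\<lambda>b d. sweedler (\<lambda>p q. ?f p * ?g q * ?h d) b) a"
    by (simp add: apply_convolve additive_tensor_sum[of "\<lambda>x. x * ?h d" for d] mult_simps)
  also have "\<dots> = sweedler (\<lambda>p d. sweedler (\<lambda>q c. ?f p * ?g q * ?h c) d) a"
    by (rule sweedler_assoc) (simp_all add: hopf_linear_simps apply_linmap_linear)
  also have "\<dots> = apply_linmap (convolve f (convolve g h)) a"
    by (simp add: apply_convolve additive_tensor_sum[of "\<lambda>x. ?f p * x" for p] mult_simps mult.assoc)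
  finally show "apply_linmap (convolve (convolve f g) h) a =
    apply_linmap (convolve f (convolve g h)) a" .
qed

lift_definition convolve_unit :: "('h, 'h) linmap" is "\<lambda>a. \<epsilon> a *\<^sub>C 1"
  by (rule clinearI) (simp_all add: hopf_linear_simps)

lemma convolve_unit: "convolve convolve_unit f = f" "convolve f convolve_unit = f"
proof -
  have f: "clinear (apply_linmap f)" using apply_linmap[of f] by simp
  show "convolve convolve_unit f = f" "convolve f convolve_unit = f"
    by (rule linmap_eqI; simp add: apply_convolve convolve_unit.rep_eq hopf_linear_simps
        sweedler_counit_left[OF f] sweedler_counit_right[OF f])+
qed

text \<open>
  The maps \<open>(a, b) \<mapsto> S (a * b)\<close> and \<open>(a, b) \<mapsto> S b * S a\<close> are a left and a right convolution
  inverse of the multiplication. The two variables are treated one at a time: \<open>b\<close> through the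
  convolution algebra of \<open>H\<close>, which serves as target algebra for the convolution in \<open>a\<close>.
\<close>

lemma antipode_mult: "S (a * b) = S b * S a"
proof -
  define f where "f a = Linmap (\<lambda>b. S (a * b))" for a
  define g where "g a = Linmap (\<lambda>b. a * b)" for a :: 'h
  define h where "h a = Linmap (\<lambda>b. S b * S a)" for a
  have app: "apply_linmap (f a) b = S (a * b)" "apply_linmap (g a) b = a * b"
    "apply_linmap (h a) b = S b * S a" for a b
    unfolding f_def g_def h_def
    by (subst Linmap_inverse; simp add: clinearI hopf_linear_simps)+
  have "f a = h a"
  proof (rule convolution_inverse_unique[OF cbilinear_convolve convolve_assoc convolve_unit])
    show "clinear f" "clinear g" "clinear h"
      by (rule clinearI; rule linmap_eqI;
          simp add: app plus_linmap.rep_eq scaleC_linmap.rep_eq hopf_linear_simps)+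
  next
    fix a
    show "sweedler (\<lambda>b c. convolve (f b) (g c)) a = \<epsilon> a *\<^sub>C convolve_unit"
    proof (rule linmap_eqI)
      fix b
      have "apply_linmap (sweedler (\<lambda>b c. convolve (f b) (g c)) a) b =
          sweedler (\<lambda>p q. S p * q) (a * b)"
        by (subst sweedler_mult) (simp_all add: apply_tensor_sum apply_convolve app hopf_linear_simps)
      then show "apply_linmap (sweedler (\<lambda>b c. convolve (f b) (g c)) a) b =
          apply_linmap (\<epsilon> a *\<^sub>C convolve_unit) b"
        by (simp add: sweedler_antipode_left scaleC_linmap.rep_eq convolve_unit.rep_eq counit_mult
            complex_vector.scale_scale)
    qed
    show "sweedler (\<lambda>b c. convolve (g b) (h c)) a = \<epsilon> a *\<^sub>C convolve_unit"
    proof (rule linmap_eqI)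
      fix b
      have "apply_linmap (sweedler (\<lambda>b c. convolve (g b) (h c)) a) b =
          sweedler (\<lambda>p q. sweedler (\<lambda>r s. p * (r * S s) * S q) b) a"
        by (simp add: apply_tensor_sum apply_convolve app mult.assoc)
      also have "\<dots> = sweedler (\<lambda>p q. p * (\<epsilon> b *\<^sub>C 1) * S q) a"
        by (simp only: sweedler_antipode_right[symmetric])
          (simp add: additive_tensor_sum[of "\<lambda>x. p * x * y" for p y] mult_simps)
      also have "\<dots> = \<epsilon> b *\<^sub>C \<epsilon> a *\<^sub>C 1"
        by (simp add: mult_simps tensor_sum_scale sweedler_antipode_right)
      finally show "apply_linmap (sweedler (\<lambda>b c. convolve (g b) (h c)) a) b =
          apply_linmap (\<epsilon> a *\<^sub>C convolve_unit) b"
        by (simp add: scaleC_linmap.rep_eq convolve_unit.rep_eq mult.commute)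
    qed
  qed
  then show ?thesis by (metis app(1,3))
qed

text \<open>
  Both sides are convolution inverses of \<open>\<Delta>\<close> with values in \<open>H \<otimes> H\<close>: the left one because \<open>\<Delta>\<close> is
  multiplicative, the right one because in the product
  \<open>a\<^sub>(\<^sub>1\<^sub>) S(a\<^sub>(\<^sub>4\<^sub>)) \<otimes> a\<^sub>(\<^sub>2\<^sub>) S(a\<^sub>(\<^sub>3\<^sub>))\<close> the inner factor \<open>a\<^sub>(\<^sub>2\<^sub>) S(a\<^sub>(\<^sub>3\<^sub>))\<close> collapses to a counit, and
  then the outer one does.
\<close>

lemma coproduct_antipode: "\<Delta> (S a) = sweedler (\<lambda>b c. S c \<otimes>\<^sub>t S b) a"
proof (rule convolution_inverse_unique[OF cbilinear_tensor_mult tensor_mult_assoc tensor_mult_one,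
      where f = "\<lambda>a. \<Delta> (S a)" and g = \<Delta>])
  show "clinear (\<lambda>a. \<Delta> (S a))" "clinear \<Delta>" "clinear (sweedler (\<lambda>b c. S c \<otimes>\<^sub>t S b))"
    by (rule clinearI; simp add: hopf_linear_simps)+
next
  fix a
  have "sweedler (\<lambda>b c. tensor_mult (\<Delta> (S b)) (\<Delta> c)) a = \<Delta> (sweedler (\<lambda>b c. S b * c) a)"
    by (simp add: coproduct_mult[symmetric] additive_tensor_sum[of \<Delta>] coproduct_linear)
  then show "sweedler (\<lambda>b c. tensor_mult (\<Delta> (S b)) (\<Delta> c)) a = \<epsilon> a *\<^sub>C (1 \<otimes>\<^sub>t 1)"
    by (simp add: sweedler_antipode_left coproduct_linear coproduct_one)
next
  fix a
  have "sweedler (\<lambda>b c. tensor_mult (\<Delta> b) (sweedler (\<lambda>r s. S s \<otimes>\<^sub>t S r) c)) a =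
      sweedler (\<lambda>b c. sweedler (\<lambda>p q. tensor_mult (p \<otimes>\<^sub>t q) (sweedler (\<lambda>r s. S s \<otimes>\<^sub>t S r) c)) b) a"
    by (simp only: tensor_mult_tensor_sum(1)[symmetric] tensor_sum_pure)
  also have "\<dots> =
      sweedler (\<lambda>b c. sweedler (\<lambda>p q. sweedler (\<lambda>r s. (p * S s) \<otimes>\<^sub>t (q * S r)) c) b) a"
    by (simp add: tensor_mult_tensor_sum(2) tensor_mult_pure)
  \<comment> \<open>Coassociativity, applied twice, makes \<open>q\<close> and \<open>r\<close> the two legs of one coproduct.\<close>
  also have "\<dots> =
      sweedler (\<lambda>p d. sweedler (\<lambda>q c. sweedler (\<lambda>r s. (p * S s) \<otimes>\<^sub>t (q * S r)) c) d) a"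
    by (rule sweedler_assoc) (simp_all add: hopf_linear_simps)
  also have "\<dots> =
      sweedler (\<lambda>p d. sweedler (\<lambda>e s. sweedler (\<lambda>q r. (p * S s) \<otimes>\<^sub>t (q * S r)) e) d) a"
    by (subst sweedler_assoc[symmetric]) (simp_all add: hopf_linear_simps)
  also have "\<dots> = sweedler (\<lambda>p d. sweedler (\<lambda>e s. (p * S s) \<otimes>\<^sub>t (\<epsilon> e *\<^sub>C 1)) d) a"
    by (simp add: sweedler_antipode_right[symmetric] pure_tensor_simps
        additive_tensor_sum[of "\<lambda>y. x \<otimes>\<^sub>t y" for x])
  also have "\<dots> = sweedler (\<lambda>p d. (p * S d) \<otimes>\<^sub>t 1) a"
  proof -
    have "clinear (\<lambda>s. (p * S s) \<otimes>\<^sub>t (1 :: 'h))" for p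
      by (rule clinearI) (simp_all add: hopf_linear_simps)
    from sweedler_counit_left[OF this] show ?thesis by (simp add: pure_tensor_simps)
  qed
  also have "\<dots> = sweedler (\<lambda>p d. p * S d) a \<otimes>\<^sub>t 1"
    by (rule additive_tensor_sum[symmetric]) (rule pure_tensor_simps)
  finally show "sweedler (\<lambda>b c. tensor_mult (\<Delta> b) (sweedler (\<lambda>r s. S s \<otimes>\<^sub>t S r) c)) a =
      \<epsilon> a *\<^sub>C (1 \<otimes>\<^sub>t 1)"
    by (simp add: sweedler_antipode_right pure_tensor_simps)
qed

end


section \<open>The antilinear automorphism star composed with the antipode\<close>

context hopf_star_algebra
begin

lemma star_add: "star (a + b) = star a + star b"
  and star_scale: "star (k *\<^sub>C a) = cnj k *\<^sub>C star a"
  using antilinear_star by (simp_all add: antilinear_def)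

lemma star_one: "star 1 = 1"
  by (metis mult_1_left mult_1_right star_mult star_star)

lemma coproduct_star_sum: "\<Delta> (star a) = sweedler (\<lambda>b c. star b \<otimes>\<^sub>t star c) a"
  unfolding coproduct_star
  by (rule tensor_antilift_eq_sum)
    (simp add: antibilinear_def antilinear_def star_add star_scale pure_tensor_simps)

lemma sweedler_star:
  assumes "cbilinear f"
  shows "sweedler f (star a) = sweedler (\<lambda>b c. f (star b) (star c)) a"
  by (simp add: coproduct_star_sum tensor_sum_tensor_sum[OF assms] tensor_sum_of_pure[OF assms])

text \<open>
  A left counit equals a right counit, and the complex conjugate of \<open>\<epsilon> \<circ> star\<close> is a left counit.
\<close>

lemma counit_star: "\<epsilon> (star a) = cnj (\<epsilon> a)"
proof -
  let ?e = "\<lambda>b. cnj (\<epsilon> (star b))"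
  have e: "clinear ?e"
    by (rule clinearI) (simp_all add: star_add star_scale counit_linear scaleC_complex_def)
  have "star a = sweedler (\<lambda>b c. \<epsilon> (star b) *\<^sub>C star c) a"
    using sweedler_counit_left[of id "star a"]
    by (simp add: clinearI sweedler_star hopf_linear_simps)
  then have "a = star (sweedler (\<lambda>b c. \<epsilon> (star b) *\<^sub>C star c) a)"
    by (metis star_star)
  also have "\<dots> = sweedler (\<lambda>b c. ?e b *\<^sub>C c) a"
    by (simp add: additive_tensor_sum[of star] star_add star_scale star_star)
  finally have "\<epsilon> a = \<epsilon> (sweedler (\<lambda>b c. ?e b *\<^sub>C c) a)" by simp
  also have "\<dots> = sweedler (\<lambda>b c. \<epsilon> c *\<^sub>C ?e b) a"
    by (simp add: additive_tensor_sum[of \<epsilon>] counit_linear scaleC_complex_def mult.commute)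
  also have "\<dots> = ?e a" by (rule sweedler_counit_right[OF e])
  finally show ?thesis by simp
qed

text \<open>
  Applying \<open>*\<close> to the antipode axiom at \<open>a\<^sup>*\<close> shows that \<open>S' = * \<circ> S \<circ> *\<close> satisfies
  \<open>a\<^sub>(\<^sub>2\<^sub>) S'(a\<^sub>(\<^sub>1\<^sub>)) = \<epsilon>(a)\<close>. Applying the antimultiplicative \<open>S\<close> to this shows that \<open>S \<circ> S'\<close> is a
  left convolution inverse of \<open>S\<close>. The identity is a right one.
\<close>

lemma antipode_star_antipode: "S (star (S (star a))) = a"
proof (rule convolution_inverse_unique[where m = "(*)" and u = 1 and g = S and h = "\<lambda>a. a"])
  show "cbilinear ((*) :: 'h \<Rightarrow> 'h \<Rightarrow> 'h)" by (simp add: cbilinear_iff mult_simps)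
  show "clinear (\<lambda>a. S (star (S (star a))))" "clinear S" "clinear (\<lambda>a :: 'h. a)"
    by (rule clinearI; simp add: hopf_linear_simps star_add star_scale)+
next
  fix a
  have bil: "cbilinear (\<lambda>b c. S b * c)" by (simp add: hopf_linear_simps)
  have "sweedler (\<lambda>b c. S (star (S (star b))) * S c) a =
      S (star (sweedler (\<lambda>b c. S (star b) * star c) a))"
    by (simp add: additive_tensor_sum[of "\<lambda>x. S (star x)"] star_add antipode_linear
        antipode_mult star_mult star_star)
  also have "sweedler (\<lambda>b c. S (star b) * star c) a = \<epsilon> (star a) *\<^sub>C 1"
    using sweedler_antipode_left[of "star a"] by (simp add: sweedler_star[OF bil])
  finally show "sweedler (\<lambda>b c. S (star (S (star b))) * S c) a = \<epsilon> a *\<^sub>C 1"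
    by (simp add: counit_star star_scale antipode_linear star_one antipode_one)
next
  show "sweedler (\<lambda>b c. S b * c) a = \<epsilon> a *\<^sub>C 1" for a by (rule sweedler_antipode_left)
qed (simp_all add: mult.assoc)

lemma antipode_star_antipode': "S (star (S a)) = star a"
  using antipode_star_antipode[of "star a"] by (simp add: star_star)

lemma star_antipode_star_antipode: "star (S (star (S a))) = a"
  by (simp add: antipode_star_antipode' star_star)

lemma inv_antipode: "inv S = (\<lambda>a. star (S (star a)))"
  by (rule inv_equality) (simp_all add: antipode_star_antipode star_antipode_star_antipode)

lemma coproduct_star_antipode:
  "\<Delta> (star (S a)) = sweedler (\<lambda>b c. star (S c) \<otimes>\<^sub>t star (S b)) a"
proof -
  let ?star2 = "tensor_antilift (\<lambda>b c. star b \<otimes>\<^sub>t star c)"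
  have bil: "antibilinear (\<lambda>b c. star b \<otimes>\<^sub>t star c)"
    by (simp add: antibilinear_def antilinear_def star_add star_scale pure_tensor_simps)
  have add: "?star2 (x + y) = ?star2 x + ?star2 y" for x y
    using tensor_antilift(1)[OF bil] by (simp add: antilinear_def)
  show ?thesis
    by (simp add: coproduct_star coproduct_antipode additive_tensor_sum[of ?star2, OF add]
        tensor_antilift(2)[OF bil])
qed

lemma sweedler_star_antipode:
  assumes "cbilinear f"
  shows "sweedler f (star (S a)) = sweedler (\<lambda>b c. f (star (S c)) (star (S b))) a"
  by (simp add: coproduct_star_antipode tensor_sum_tensor_sum[OF assms]
      tensor_sum_of_pure[OF assms])

end


section \<open>Conjugate modules and the two Hom actions\<close>

lemma left_moduleD:
  assumes "left_module act"
  shows "cbilinear act" "act 1 v = v" "act (a * b) v = act a (act b v)"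
    "act a (v + w) = act a v + act a w" "act a (k *\<^sub>C v) = k *\<^sub>C act a v"
    "act (a + b) v = act a v + act b v" "act (k *\<^sub>C a) v = k *\<^sub>C act a v"
  using assms cbilinearD[of act] unfolding left_module_def by blast+

text \<open>
  The module axioms of the right Hom action are obtained in this way from those of the left one,
  so that they need no second computation with \<open>S\<^sup>-\<^sup>1\<close>.
\<close>

lemma left_module_transport:
  assumes "left_module actX" "clinear F" "bij F"
    and F: "\<And>a x. F (actX a x) = actY a (F x)"
  shows "left_module actY"
proof -
  note X = left_moduleD[OF assms(1)] clinear_add[OF assms(2)] clinear_scale[OF assms(2)]
  have *: "(\<And>x. P (F x)) \<Longrightarrow> P y" for P y
    by (metis bij_pointE[OF assms(3)])
  show ?thesis
  proof
    show "actY 1 v = v" for v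
      by (rule *[where y = v]) (simp add: F[symmetric] X)
    show "actY (a * b) v = actY a (actY b v)" for a b v
      by (rule *[where y = v]) (simp add: F[symmetric] X)
    have "actY a (v + w) = actY a v + actY a w" for a v w
      by (rule *[where y = v], rule *[where y = w]) (simp add: F[symmetric] X(8)[symmetric] X(4))
    moreover have "actY a (k *\<^sub>C v) = k *\<^sub>C actY a v" for a k v
      by (rule *[where y = v]) (simp add: F[symmetric] X(9)[symmetric] X(5))
    moreover have "actY (a + b) v = actY a v + actY b v" for a b v
      by (rule *[where y = v]) (simp add: F[symmetric] X)
    moreover have "actY (k *\<^sub>C a) v = k *\<^sub>C actY a v" for a k v
      by (rule *[where y = v]) (simp add: F[symmetric] X)
    ultimately show "cbilinear actY" by (simp add: cbilinear_iff)
  qed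
qed

lemma (in hopf_star_algebra) left_module_conj_act:
  assumes "left_module act"
  shows "left_module (conj_act S star act)"
proof -
  note act = left_moduleD[OF assms]
  show ?thesis
    by standard (simp_all add: cbilinear_iff conj_act_def plus_cconj_def scaleC_cconj_def act
        antipode_linear star_add star_scale antipode_mult star_mult antipode_one star_one)
qed

context hopf_algebra
begin

lemma apply_hom_l_act:
  assumes "left_module actV" "left_module actW"
  shows "apply_linmap (hom_l_act \<Delta> S actV actW a T) v =
    sweedler (\<lambda>b c. actW b (apply_linmap T (actV (S c) v))) a"
proof -
  note act = left_moduleD(4-)[OF assms(1)] left_moduleD(4-)[OF assms(2)] apply_linmap_linear
  show ?thesis
    unfolding hom_l_act_def
    by (subst Linmap_inverse) (simp_all add: tensor_lift_eq_sum clinearI act hopf_linear_simps)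
qed

lemma left_module_hom_l_act:
  assumes "left_module actV" "left_module actW"
  shows "left_module (hom_l_act \<Delta> S actV actW)"
proof
  note V = left_moduleD[OF assms(1)] and W = left_moduleD[OF assms(2)]
  note lin = V(4-) W(4-) apply_linmap_linear plus_linmap.rep_eq scaleC_linmap.rep_eq
  note app = apply_hom_l_act[OF assms]
  have bil: "cbilinear (\<lambda>b c. actW b (apply_linmap T (actV (S c) v)))" for T v
    by (simp add: lin hopf_linear_simps)
  show "cbilinear (hom_l_act \<Delta> S actV actW)"
    unfolding cbilinear_iff
    by (intro conjI allI; rule linmap_eqI; simp add: app lin hopf_linear_simps)
  fix a b T
  show "hom_l_act \<Delta> S actV actW 1 T = T"
    by (rule linmap_eqI) (simp add: app sweedler_one[OF bil] antipode_one V(2) W(2))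
  show "hom_l_act \<Delta> S actV actW (a * b) T =
      hom_l_act \<Delta> S actV actW a (hom_l_act \<Delta> S actV actW b T)"
    by (rule linmap_eqI)
      (simp add: app sweedler_mult[OF bil] antipode_mult V(3) W(3) W(4)
        additive_tensor_sum[of "actW p" for p])
qed

end

context hopf_star_algebra
begin

lemma apply_hom_r_act:
  assumes "left_module actV" "left_module actW"
  shows "apply_linmap (hom_r_act \<Delta> S actV actW a T) v =
    sweedler (\<lambda>b c. actW c (apply_linmap T (actV (inv S b) v))) a"
proof -
  note act = left_moduleD(4-)[OF assms(1)] left_moduleD(4-)[OF assms(2)] apply_linmap_linear
  show ?thesis
    unfolding hom_r_act_def inv_antipode
    by (subst Linmap_inverse)
      (simp_all add: tensor_lift_eq_sum clinearI act star_add star_scale hopf_linear_simps)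
qed

text \<open>
  Conjugating the two module actions turns \<open>b \<otimes> c\<close> into \<open>S(c)\<^sup>* \<otimes> b\<^sup>*\<close>, since
  \<open>S(S\<^sup>-\<^sup>1(b))\<^sup>* = b\<^sup>*\<close>; this agrees with \<open>id \<otimes> S\<close> applied to
  \<open>\<Delta>(S(a)\<^sup>*) = S(a\<^sub>(\<^sub>2\<^sub>))\<^sup>* \<otimes> S(a\<^sub>(\<^sub>1\<^sub>))\<^sup>*\<close>. The flip in \<open>\<Delta> \<circ> S\<close> is what exchanges the left and the
  right Hom action.
\<close>

lemma conj_map_hom_l_act:
  fixes actV :: "'h \<Rightarrow> 'v::complex_vector \<Rightarrow> 'v" and actW :: "'h \<Rightarrow> 'w::complex_vector \<Rightarrow> 'w"
  assumes V: "left_module actV" and W: "left_module actW"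
  shows "conj_map (hom_l_act \<Delta> S actV actW (star (S a)) T) =
    hom_r_act \<Delta> S (conj_act S star actV) (conj_act S star actW) a (conj_map T)"
proof (rule linmap_eqI)
  fix x :: "'v cconj"
  note act = left_moduleD(4-)[OF V] left_moduleD(4-)[OF W] apply_linmap_linear
  let ?v = "of_cconj x"
  have bil: "cbilinear (\<lambda>b c. actW b (apply_linmap T (actV (S c) ?v)))"
    by (simp add: act hopf_linear_simps)
  have "apply_linmap (conj_map (hom_l_act \<Delta> S actV actW (star (S a)) T)) x =
      to_cconj (sweedler (\<lambda>b c. actW (star (S c)) (apply_linmap T (actV (S (star (S b))) ?v))) a)"
    by (simp add: conj_map.rep_eq apply_hom_l_act[OF V W] sweedler_star_antipode[OF bil])
  also have "\<dots> =
      sweedler (\<lambda>b c. to_cconj (actW (star (S c)) (apply_linmap T (actV (S (star (S b))) ?v)))) a"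
    by (rule additive_tensor_sum) (simp add: plus_cconj_def)
  also have "\<dots> = apply_linmap
      (hom_r_act \<Delta> S (conj_act S star actV) (conj_act S star actW) a (conj_map T)) x"
    by (simp add: apply_hom_r_act left_module_conj_act V W conj_act_def conj_map.rep_eq
        inv_antipode antipode_star_antipode' star_star)
  finally show "apply_linmap (conj_map (hom_l_act \<Delta> S actV actW (star (S a)) T)) x = apply_linmap
      (hom_r_act \<Delta> S (conj_act S star actV) (conj_act S star actW) a (conj_map T)) x" .
qed

end

lemma antilinear_conj_map: "antilinear conj_map"
  unfolding antilinear_def
  by (transfer; simp add: plus_cconj_def scaleC_cconj_def)

lemma bij_conj_map: "bij conj_map"
proof (rule bijI)
  show "inj (conj_map :: ('a, 'b) linmap \<Rightarrow> _)"
    by (rule injI) (metis apply_linmap_inject cconj.sel conj_map.rep_eq ext)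
next
  have "conj_map (Linmap (\<lambda>v. of_cconj (apply_linmap Y (to_cconj v)))) = Y"
    for Y :: "('a cconj, 'b cconj) linmap"
  proof -
    have Y: "clinear (apply_linmap Y)" using apply_linmap[of Y] by simp
    have "clinear (\<lambda>v. of_cconj (apply_linmap Y (to_cconj v)))"
    proof (rule clinearI)
      fix x y :: 'a and k
      show "of_cconj (apply_linmap Y (to_cconj (x + y))) =
          of_cconj (apply_linmap Y (to_cconj x)) + of_cconj (apply_linmap Y (to_cconj y))"
        using clinear_add[OF Y, of "to_cconj x" "to_cconj y"] by (simp add: plus_cconj_def)
      show "of_cconj (apply_linmap Y (to_cconj (k *\<^sub>C x))) =
          k *\<^sub>C of_cconj (apply_linmap Y (to_cconj x))"
        using clinear_scale[OF Y, of "cnj k" "to_cconj x"] by (simp add: scaleC_cconj_def)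
    qed
    then show ?thesis
      by (intro linmap_eqI) (simp add: conj_map.rep_eq Linmap_inverse)
  qed
  then show "surj (conj_map :: ('a, 'b) linmap \<Rightarrow> _)" by (rule surjI)
qed

theorem proposition4p10:
  fixes \<Delta> :: "'h::complex_algebra_1 \<Rightarrow> 'h \<otimes> 'h"
    and \<epsilon> :: "'h \<Rightarrow> complex"
    and S star :: "'h \<Rightarrow> 'h"
    and actV :: "'h \<Rightarrow> 'v::complex_vector \<Rightarrow> 'v"
    and actW :: "'h \<Rightarrow> 'w::complex_vector \<Rightarrow> 'w"
  assumes "hopf_star_algebra \<Delta> \<epsilon> S star"
    and "left_module actV"
    and "left_module actW"
  shows "(bij (conj_map :: ('v, 'w) linmap \<Rightarrow> ('v cconj, 'w cconj) linmap) \<and>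
          antimodule_map S star
            (hom_l_act \<Delta> S actV actW)
            (hom_r_act \<Delta> S (conj_act S star actV) (conj_act S star actW)) conj_map) \<and>
         module_isomorphism
            (conj_act S star (hom_l_act \<Delta> S actV actW))
            (hom_r_act \<Delta> S (conj_act S star actV) (conj_act S star actW)) (conj_map \<circ> inv to_cconj)"
proof -
  interpret hopf_star_algebra \<Delta> \<epsilon> S star by fact
  let ?l = "hom_l_act \<Delta> S actV actW"
  let ?r = "hom_r_act \<Delta> S (conj_act S star actV) (conj_act S star actW)"
  let ?b = "conj_map :: ('v, 'w) linmap \<Rightarrow> ('v cconj, 'w cconj) linmap"
  let ?\<beta> = "?b \<circ> inv to_cconj"
  have l: "left_module ?l"
    using assms(2,3) by (rule left_module_hom_l_act)
  have key: "?b (?l (star (S a)) T) = ?r a (?b T)" for a T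
    using assms(2,3) by (rule conj_map_hom_l_act)
  have inv: "inv to_cconj = (of_cconj :: ('v, 'w) linmap cconj \<Rightarrow> ('v, 'w) linmap)"
    by (rule inv_equality) simp_all
  have "bij (of_cconj :: ('v, 'w) linmap cconj \<Rightarrow> ('v, 'w) linmap)"
    by (metis bijI' cconj.collapse cconj.sel)
  then have \<beta>_bij: "bij ?\<beta>"
    unfolding inv by (rule bij_comp) (rule bij_conj_map)
  have b: "antilinear ?b"
    by (rule antilinear_conj_map)
  \<comment> \<open>Two antilinear maps compose to a linear one.\<close>
  then have \<beta>_linear: "clinear ?\<beta>"
    by (intro clinearI) (simp_all add: inv antilinear_def plus_cconj_def scaleC_cconj_def)
  have \<beta>_equivariant: "?\<beta> (conj_act S star ?l a x) = ?r a (?\<beta> x)" for a x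
    by (simp add: inv conj_act_def key)
  have conj_l: "left_module (conj_act S star ?l)"
    using l by (rule left_module_conj_act)
  have r: "left_module ?r"
    using conj_l \<beta>_linear \<beta>_bij \<beta>_equivariant by (rule left_module_transport)
  \<comment> \<open>\<open>a \<mapsto> S(a)\<^sup>*\<close> is an involution, so it can be moved to the other side of \<open>key\<close>.\<close>
  have "?b (?l a T) = ?r (star (S a)) (?b T)" for a T
    using key[of "star (S a)"] by (simp add: star_antipode_star_antipode)
  then show ?thesis
    unfolding antimodule_map_def module_isomorphism_def
    using l r conj_l bij_conj_map b \<beta>_linear \<beta>_bij \<beta>_equivariant by blast
qed

end
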